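(* The Clifford isoparametric families of multiplicities $(1,k)$ and $(2,2k-1)$ ($k\ge1$), and the Clifford isoparametric families of multiplicities $(4,4k-1)$ ($k\ge1$) with $P_0P_1P_2P_3P_4=\pm\mathrm{Id}$, are homogeneous.
   Context: A (symmetric) Clifford system on $\mathbb{R}^{2l}$ is an $(m+1)$-tuple $(P_0,\dots,P_m)$ of symmetric endomorphisms of $\mathbb{R}^{2l}$ with $P_iP_j+P_jP_i=2\delta_{ij}\,\mathrm{Id}$ for all $i,j$. Put $m_1=m$, $m_2=l-m-1$. If $m_2>0$, the associated Clifford isoparametric family of multiplicities $(m_1,m_2)$ consists of the level sets $f^{-1}(c)$, $-1<c<1$, of $f(x)=1-2\sum_{i=0}^m\langle P_ix,x\rangle^2$ on $S^{2l-1}$ (a parallel family of hypersurfaces with four distinct constant principal curvatures of multiplicities $m_1,m_2,m_1,m_2$). The family is homogeneous if each of its hypersurfaces $M$ is homogeneously embedded, i.e. the group $\{A\in O(2l)\mid A(M)=M\}$ acts transitively on $M$. *)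

theory Defs
  imports "HOL-Analysis.Analysis"
begin

text \<open>
  The tuple \<open>(P\<^sub>0, \<dots>, P\<^sub>m)\<close> is a function on the natural numbers of which only the
  values at \<open>0, \<dots>, m\<close> are relevant.
\<close>

definition symmetric_endomorphism :: "(real ^ 'n \<Rightarrow> real ^ 'n) \<Rightarrow> bool" where
  "symmetric_endomorphism T \<longleftrightarrow> linear T \<and> (\<forall>x y. T x \<bullet> y = x \<bullet> T y)"

definition clifford_system :: "nat \<Rightarrow> (nat \<Rightarrow> real ^ 'n \<Rightarrow> real ^ 'n) \<Rightarrow> bool" where
  "clifford_system m P \<longleftrightarrow>
     (\<exists>l. CARD('n) = 2 * l) \<and>
     (\<forall>i\<le>m. symmetric_endomorphism (P i)) \<and>
     (\<forall>i\<le>m. \<forall>j\<le>m. \<forall>x. P i (P j x) + P j (P i x) = (if i = j then 2 else 0) *\<^sub>R x)"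

definition clifford_function :: "nat \<Rightarrow> (nat \<Rightarrow> real ^ 'n \<Rightarrow> real ^ 'n) \<Rightarrow> real ^ 'n \<Rightarrow> real" where
  "clifford_function m P x = 1 - 2 * (\<Sum>i=0..m. (P i x \<bullet> x)\<^sup>2)"

definition clifford_family :: "nat \<Rightarrow> (nat \<Rightarrow> real ^ 'n \<Rightarrow> real ^ 'n) \<Rightarrow> (real ^ 'n) set set" where
  "clifford_family m P =
     {{x \<in> sphere 0 1. clifford_function m P x = c} | c. -1 < c \<and> c < 1}"

text \<open>
  With \<open>CARD('n) = 2 * l\<close>, the multiplicities of the family of \<open>(P\<^sub>0, \<dots>, P\<^sub>m)\<close> are
  \<open>m\<^sub>1 = m\<close> and \<open>m\<^sub>2 = l - m - 1\<close>, and \<open>m\<^sub>2\<close> has to be positive.  The equation for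
  \<open>m\<^sub>2\<close> is read in the integers.
\<close>

definition clifford_family_multiplicities ::
    "(nat \<Rightarrow> real ^ 'n \<Rightarrow> real ^ 'n) \<Rightarrow> nat \<Rightarrow> nat \<Rightarrow> bool" where
  "clifford_family_multiplicities P m1 m2 \<longleftrightarrow>
     clifford_system m1 P \<and>
     (\<exists>l. CARD('n) = 2 * l \<and> int m2 = int l - int m1 - 1) \<and> m2 > 0"

definition symmetry_group :: "(real ^ 'n) set \<Rightarrow> (real ^ 'n \<Rightarrow> real ^ 'n) set" where
  "symmetry_group M = {A. orthogonal_transformation A \<and> A ` M = M}"

definition homogeneously_embedded :: "(real ^ 'n) set \<Rightarrow> bool" where
  "homogeneously_embedded M \<longleftrightarrow> (\<forall>x\<in>M. \<forall>y\<in>M. \<exists>A\<in>symmetry_group M. A x = y)"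

definition homogeneous_family :: "(real ^ 'n) set set \<Rightarrow> bool" where
  "homogeneous_family F \<longleftrightarrow> (\<forall>M\<in>F. homogeneously_embedded M)"

end

theory Submission imports Defs
begin

text \<open>
  Write \<open>p(x)\<close> for the vector of the values \<open>P i x \<bullet> x\<close>, so that a level set prescribes the norm
  of \<open>p(x)\<close>.  For a unit vector \<open>e\<close> the symmetric involution \<open>\<Sum>i. e i P i\<close> acts on \<open>p\<close> as minus
  the reflection along \<open>e\<close>, so it preserves the level sets, and a suitable \<open>e\<close> takes
  \<open>p(x)\<close> to \<open>p(y)\<close>.  It remains to treat unit vectors with \<open>p(x) = p(y)\<close>.  Up to sign, a word
  in the \<open>P i\<close> is a word \<open>w\<close> with distinct letters; those of length 2 and 3 are skew-symmetric, and for
  \<open>m = 4\<close> the hypothesis on the product reduces lengths 4 and 5 to 1 and 0.  Hence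
  \<open>w x \<bullet> x = w y \<bullet> y\<close> for all words \<open>w\<close>: the cyclic modules generated by \<open>x\<close> and \<open>y\<close> are
  isometric, and a Witt type extension argument gives an orthogonal map that commutes with all
  \<open>P i\<close> and takes \<open>x\<close> to \<open>y\<close>.
\<close>

section \<open>Linear isometries obtained from their graphs\<close>

lemma span_eq_inner_fst_snd:
  fixes S :: "('a::euclidean_space \<times> 'a) set"
  assumes S: "\<And>p q. p \<in> S \<Longrightarrow> q \<in> S \<Longrightarrow> fst p \<bullet> fst q = snd p \<bullet> snd q"
    and p: "p \<in> span S" and q: "q \<in> span S"
  shows "fst p \<bullet> fst q = snd p \<bullet> snd q"
proof -
  have left: "fst p \<bullet> fst q = snd p \<bullet> snd q" if "q \<in> S" for q
    using p
  proof (induction rule: span_induct_alt)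
    case base
    then show ?case by simp
  next
    case (step c a b)
    then show ?case using S[OF \<open>a \<in> S\<close> that] by (simp add: inner_add_left)
  qed
  show ?thesis
    using q
  proof (induction rule: span_induct_alt)
    case base
    then show ?case by simp
  next
    case (step c a b)
    then show ?case using left[OF \<open>a \<in> S\<close>] by (simp add: inner_add_right)
  qed
qed

text \<open>A pair in \<open>R\<close> with first component 0 has a second component of norm 0, so
  \<open>fst\<close> is injective on \<open>R\<close>. The bound on \<open>dim R\<close> then makes
  \<open>fst\<close> onto, and \<open>R\<close> is the graph of a map.\<close>

lemma isometric_total_relation_imp_orthogonal_transformation:
  fixes R :: "('a::euclidean_space \<times> 'a) set"
  assumes R: "subspace R"
    and inner: "\<And>p q. p \<in> R \<Longrightarrow> q \<in> R \<Longrightarrow> fst p \<bullet> fst q = snd p \<bullet> snd q"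
    and dim: "DIM('a) \<le> dim R"
  obtains A where "orthogonal_transformation A" "\<And>v w. (v, w) \<in> R \<longleftrightarrow> w = A v"
proof -
  have fst0: "q = 0" if "q \<in> R" "fst q = 0" for q
    using inner[OF that(1) that(1)] that(2) by (simp add: prod_eq_iff)
  have inj: "inj_on fst (span R)"
  proof (rule inj_onI)
    fix p q assume pq: "p \<in> span R" "q \<in> span R" "fst p = fst q"
    then have "p - q \<in> R" using R by (metis span_eq_iff subspace_diff)
    then show "p = q" using fst0[of "p - q"] pq(3) by (simp add: fst_diff)
  qed
  have "dim (fst ` R) = dim R"
    using linear_fst inj by (rule dim_image_eq)
  moreover have "subspace (fst ` R)"
    using linear_subspace_image[OF linear_fst R] .
  ultimately have tot: "fst ` R = UNIV"
    using dim by (metis dim_eq_full dim_subset_UNIV le_antisym span_eq_iff)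
  have ex1: "\<exists>!w. (v, w) \<in> R" for v
  proof -
    have "v \<in> fst ` R" using tot by simp
    then obtain w where w: "(v, w) \<in> R" by force
    moreover have "w' = w" if "(v, w') \<in> R" for w'
      using inj_onD[OF inj, of "(v, w')" "(v, w)"] w that by (simp add: span_base)
    ultimately show ?thesis by blast
  qed
  define A where "A v = (THE w. (v, w) \<in> R)" for v
  have A: "(v, w) \<in> R \<longleftrightarrow> w = A v" for v w
    unfolding A_def using ex1[of v] by (metis theI')
  have mem: "(v, A v) \<in> R" for v using A by simp
  have "linear A"
  proof (rule linearI)
    show "A (v + w) = A v + A w" for v w
      using subspace_add[OF R mem[of v] mem[of w]] A by simp
    show "A (c *\<^sub>R v) = c *\<^sub>R A v" for c v
      using subspace_scale[OF R mem[of v], of c] A by simp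
  qed
  moreover have "A v \<bullet> A w = v \<bullet> w" for v w
    using inner[OF mem[of v] mem[of w]] by simp
  ultimately have "orthogonal_transformation A"
    by (simp add: orthogonal_transformation_def)
  then show thesis using that A by blast
qed

section \<open>Words in symmetric operators and extension of isometries between cyclic
  modules\<close>

lemma linear_foldr:
  assumes "\<And>i. i \<in> I \<Longrightarrow> linear (P i)" "set ws \<subseteq> I"
  shows "linear (foldr P ws)"
  using assms(2)
proof (induction ws)
  case Nil
  then show ?case by (simp add: linear_id id_def[symmetric] linear_ident)
next
  case (Cons i ws)
  then show ?case using linear_compose[of "foldr P ws" "P i"] assms(1) by (auto simp: comp_def)
qed

lemma inner_foldr_rev:
  assumes "\<And>i v w. i \<in> I \<Longrightarrow> P i v \<bullet> w = v \<bullet> P i w" "set ws \<subseteq> I"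
  shows "foldr P ws v \<bullet> w = v \<bullet> foldr P (rev ws) w"
  using assms(2)
proof (induction ws arbitrary: w)
  case (Cons i ws)
  then show ?case using assms(1)[of i] by simp
qed simp

text \<open>
  The graph \<open>R\<close> of the required map is spanned by the pairs \<open>(w x, w y)\<close> and by the diagonal over
  the orthogonal complement \<open>N\<close> of \<open>U = span {w (x - y)}\<close>.  It is total by a dimension count:
  \<open>(a, b) \<mapsto> a - b\<close> vanishes on that diagonal and maps its complement in \<open>R\<close> onto \<open>U\<close>.
\<close>

lemma commuting_orthogonal_transformation_exists:
  fixes P :: "'i \<Rightarrow> 'a::euclidean_space \<Rightarrow> 'a"
  assumes lin: "\<And>i. i \<in> I \<Longrightarrow> linear (P i)"
    and sym: "\<And>i v w. i \<in> I \<Longrightarrow> P i v \<bullet> w = v \<bullet> P i w"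
    and eq: "\<And>ws. set ws \<subseteq> I \<Longrightarrow> foldr P ws x \<bullet> x = foldr P ws y \<bullet> y"
  obtains A where "orthogonal_transformation A" "A x = y"
    "\<And>i v. i \<in> I \<Longrightarrow> A (P i v) = P i (A v)"
proof -
  define W where "W = {ws. set ws \<subseteq> I}"
  define G where "G = (\<lambda>ws. (foldr P ws x, foldr P ws y)) ` W"
  define U where "U = span ((\<lambda>ws. foldr P ws (x - y)) ` W)"
  define N where "N = {v. \<forall>u\<in>U. orthogonal u v}"
  define D where "D = (\<lambda>v. (v, v)) ` N"
  define R where "R = span (G \<union> D)"
  have linW: "linear (foldr P ws)" if "ws \<in> W" for ws
    using linear_foldr[OF lin] that by (auto simp: W_def)
  have diffW: "foldr P ws (x - y) = foldr P ws x - foldr P ws y" if "ws \<in> W" for ws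
    using linW[OF that] by (rule linear_diff)
  have subU: "subspace U" unfolding U_def by (rule subspace_span)
  have subN: "subspace N"
    unfolding N_def by (auto simp: subspace_def orthogonal_def inner_simps)
  have memN: "v \<in> N \<longleftrightarrow> (\<forall>ws\<in>W. foldr P ws (x - y) \<bullet> v = 0)" for v
  proof
    assume "v \<in> N"
    then show "\<forall>ws\<in>W. foldr P ws (x - y) \<bullet> v = 0"
      unfolding N_def U_def orthogonal_def by (blast intro: span_base)
  next
    assume orth: "\<forall>ws\<in>W. foldr P ws (x - y) \<bullet> v = 0"
    have "orthogonal v u" if "u \<in> U" for u
      using that[unfolded U_def]
    proof (rule orthogonal_to_span)
      fix u assume "u \<in> (\<lambda>ws. foldr P ws (x - y)) ` W"
      then show "orthogonal v u" using orth by (auto simp: orthogonal_def inner_commute[of v])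
    qed
    then show "v \<in> N" unfolding N_def by (simp add: orthogonal_commute)
  qed
  have subD: "subspace D" unfolding D_def
    using linear_subspace_image[OF _ subN, of "\<lambda>v. (v, v)"] by (simp add: linear_iff)
  have dimD: "dim D = dim N"
    unfolding D_def by (rule dim_image_eq) (auto simp: linear_iff inj_on_def)
  have subR: "subspace R" unfolding R_def by (rule subspace_span)
  have DR: "D \<subseteq> R" and GR: "G \<subseteq> R" unfolding R_def by (auto intro: span_base)
  have innerW: "foldr P vs x \<bullet> foldr P ws x = foldr P vs y \<bullet> foldr P ws y"
    if "vs \<in> W" "ws \<in> W" for vs ws
  proof -
    \<comment> \<open>Symmetry of the letters moves \<open>vs\<close> to the other side in reversed
      order, so an inner product of two words is the value of a single word, to which
      \<open>eq\<close> applies.\<close>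
    have "foldr P ws z \<bullet> foldr P vs z = foldr P (rev vs @ ws) z \<bullet> z" for z
    proof -
      have "foldr P (rev vs) (foldr P ws z) \<bullet> z = foldr P ws z \<bullet> foldr P vs z"
        using inner_foldr_rev[where P = P and I = I and ws = "rev vs", OF sym] that
        by (simp add: W_def)
      then show ?thesis by simp
    qed
    moreover have "set (rev vs @ ws) \<subseteq> I" using that by (auto simp: W_def)
    ultimately show ?thesis using eq by (metis inner_commute)
  qed
  \<comment> \<open>This supplies the mixed products of \<open>G\<close> with \<open>D\<close>:
    vectors of \<open>N\<close> are orthogonal to the difference of the two components of a pair in
    \<open>G\<close>.\<close>
  have orthN: "foldr P ws x \<bullet> v = foldr P ws y \<bullet> v" if "ws \<in> W" "v \<in> N" for ws v
    using that memN[of v] diffW[OF that(1)] by (auto simp: inner_diff_left)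
  have innerGD: "fst p \<bullet> fst q = snd p \<bullet> snd q" if "p \<in> G \<union> D" "q \<in> G \<union> D" for p q
    using that innerW orthN unfolding G_def D_def by (auto simp: inner_commute)
  have innerR: "fst p \<bullet> fst q = snd p \<bullet> snd q" if "p \<in> R" "q \<in> R" for p q
    using span_eq_inner_fst_snd[OF innerGD] that unfolding R_def by blast
  define C where "C = {r \<in> R. \<forall>d\<in>D. orthogonal d r}"
  have subC: "subspace C" using subR
    unfolding C_def by (auto simp: subspace_def orthogonal_def inner_simps)
  let ?f = "\<lambda>p. fst p - snd p"
  have linf: "linear ?f" by (intro linear_compose_sub linear_fst linear_snd)
  have "foldr P ws (x - y) \<in> ?f ` C" if ws: "ws \<in> W" for ws
  proof -
    \<comment> \<open>Let \<open>n\<close> be the component of \<open>foldr P ws x\<close> in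
      \<open>N\<close>. Subtracting the pair \<open>(n, n)\<close> of \<open>D\<close> moves the
      generator into \<open>C\<close> and keeps the difference of its components.\<close>
    obtain n s where n: "n \<in> span N" and s: "\<And>w. w \<in> span N \<Longrightarrow> orthogonal s w"
      and xs: "foldr P ws x = n + s"
      using orthogonal_subspace_decomp_exists by metis
    have nN: "n \<in> N" using n subN by (simp add: span_eq_iff[THEN iffD2])
    let ?p = "(foldr P ws x - n, foldr P ws y - n)"
    have "(foldr P ws x, foldr P ws y) \<in> R" "(n, n) \<in> R"
      using GR DR ws nN by (auto simp: G_def D_def)
    then have "?p \<in> R" using subspace_diff[OF subR] by fastforce
    moreover have "orthogonal d ?p" if d: "d \<in> D" for d
    proof -
      obtain v where v: "d = (v, v)" "v \<in> N" using d unfolding D_def by auto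
      have "(foldr P ws x - n) \<bullet> v = 0"
        using s[OF span_base[OF v(2)]] xs by (simp add: orthogonal_def)
      moreover have "(foldr P ws y - n) \<bullet> v = (foldr P ws x - n) \<bullet> v"
        using orthN[OF ws v(2)] by (simp add: inner_diff_left)
      ultimately show ?thesis by (simp add: v(1) orthogonal_def inner_commute)
    qed
    ultimately have "?p \<in> C" unfolding C_def by blast
    then show ?thesis using diffW[OF ws] by (auto intro!: image_eqI[of _ _ ?p])
  qed
  then have "U \<subseteq> ?f ` C"
    unfolding U_def by (intro span_minimal linear_subspace_image[OF linf subC]) blast
  then have "dim U \<le> dim (?f ` C)" by (rule dim_subset)
  also have "\<dots> \<le> dim C" by (rule dim_image_le[OF linf])
  finally have "dim U \<le> dim C" .
  moreover have "dim C + dim D = dim R"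
    unfolding C_def by (rule dim_subspace_orthogonal_to_vectors[OF subD subR DR])
  moreover have "dim N + dim U = DIM('a)"
    using dim_subspace_orthogonal_to_vectors[OF subU subspace_UNIV] by (simp add: N_def)
  ultimately have "DIM('a) \<le> dim R" using dimD by linarith
  then obtain A where A: "orthogonal_transformation A" "\<And>v w. (v, w) \<in> R \<longleftrightarrow> w = A v"
    using isometric_total_relation_imp_orthogonal_transformation[OF subR innerR] by blast
  have "(x, y) \<in> G" unfolding G_def W_def by (auto intro!: image_eqI[of _ _ "[]"])
  then have "A x = y" using GR A(2) by auto
  moreover have "A (P i v) = P i (A v)" if i: "i \<in> I" for i v
  proof -
    \<comment> \<open>Commuting with \<open>P i\<close> means that the graph \<open>R\<close> is
      invariant under \<open>P i\<close> applied to both components; this is checked on the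
      generators.\<close>
    have linP: "linear (\<lambda>p. (P i (fst p), P i (snd p)))"
      using lin[OF i] by (simp add: linear_iff)
    have "(P i (fst p), P i (snd p)) \<in> G \<union> D" if "p \<in> G \<union> D" for p
      using that
    proof
      assume "p \<in> G"
      then obtain ws where "ws \<in> W" "p = (foldr P ws x, foldr P ws y)" unfolding G_def by auto
      then show ?thesis using i
        by (auto simp: G_def W_def intro!: image_eqI[of _ _ "i # ws"])
    next
      assume "p \<in> D"
      then obtain w where w: "p = (w, w)" "w \<in> N" unfolding D_def by auto
      \<comment> \<open>\<open>U\<close> is invariant under the symmetric map \<open>P i\<close>,
        hence so is its orthogonal complement \<open>N\<close>.\<close>
      have "foldr P ws (x - y) \<bullet> P i w = 0" if "ws \<in> W" for ws
      proof -
        have "i # ws \<in> W" using that i by (simp add: W_def)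
        then have "foldr P (i # ws) (x - y) \<bullet> w = 0" using w(2) memN by blast
        then show ?thesis using sym[OF i] by simp
      qed
      then have "P i w \<in> N" unfolding memN by blast
      then show ?thesis using w(1) unfolding D_def by auto
    qed
    then have "(\<lambda>p. (P i (fst p), P i (snd p))) ` R \<subseteq> R"
      unfolding R_def linear_span_image[OF linP, symmetric] by (intro span_mono) blast
    moreover have "(v, A v) \<in> R" using A(2) by blast
    ultimately have "(P i v, P i (A v)) \<in> R" by force
    then show ?thesis using A(2) by simp
  qed
  ultimately show thesis using that A(1) by blast
qed


section \<open>Reduction of words in a Clifford system\<close>

locale clifford =
  fixes m :: nat and P :: "nat \<Rightarrow> real ^ 'n \<Rightarrow> real ^ 'n"
  assumes system: "clifford_system m P"
begin

lemma linear_P: "i \<le> m \<Longrightarrow> linear (P i)"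
  using system by (simp add: clifford_system_def symmetric_endomorphism_def)

lemma symmetric_P: "i \<le> m \<Longrightarrow> P i v \<bullet> w = v \<bullet> P i w"
  using system by (simp add: clifford_system_def symmetric_endomorphism_def)

lemma anticommute: "i \<le> m \<Longrightarrow> j \<le> m \<Longrightarrow> i \<noteq> j \<Longrightarrow> P i (P j v) = - P j (P i v)"
  using system by (simp add: clifford_system_def eq_neg_iff_add_eq_0)

lemma involution: "i \<le> m \<Longrightarrow> P i (P i v) = v"
proof -
  assume "i \<le> m"
  then have "P i (P i v) + P i (P i v) = 2 *\<^sub>R v"
    using system by (auto simp: clifford_system_def)
  then have "2 *\<^sub>R P i (P i v) = 2 *\<^sub>R v" by (simp add: scaleR_2)
  then show ?thesis by simp
qed

text \<open>\<open>P i\<close> passes each letter equal to \<open>i\<close> with sign 1 and every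
  other letter with sign -1. The scalar \<open>s\<close> does not depend on \<open>v\<close>, so it
  is the same factor at \<open>x\<close> and at \<open>y\<close> when values are compared.\<close>

lemma foldr_commute:
  assumes "set ws \<subseteq> {..m}" "i \<le> m"
  obtains s :: real where "\<And>v. P i (foldr P ws v) = s *\<^sub>R foldr P ws (P i v)"
  using assms(1)
proof (induction ws arbitrary: thesis)
  case Nil
  show ?case by (rule Nil.prems(1)[of 1]) simp
next
  case (Cons j ws)
  have j: "j \<le> m" and ws: "set ws \<subseteq> {..m}" using Cons.prems by auto
  obtain s :: real where s: "\<And>v. P i (foldr P ws v) = s *\<^sub>R foldr P ws (P i v)"
    using Cons.IH ws by blast
  have "P i (foldr P (j # ws) v) =
      ((if i = j then 1 else -1) * s) *\<^sub>R foldr P (j # ws) (P i v)" for v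
    using s[of v] anticommute[of i j "foldr P ws v"] linear_P[OF j] j assms(2)
    by (cases "i = j") (auto simp: linear_scale)
  then show ?case by (rule Cons.prems(1))
qed

text \<open>The first letter of \<open>vs\<close> is pulled out of its place in \<open>ws\<close> at
  the cost of a scalar; induction handles the rest.\<close>

lemma foldr_mset_eq:
  assumes "mset vs = mset ws" "set vs \<subseteq> {..m}"
  obtains s :: real where "\<And>v. foldr P vs v = s *\<^sub>R foldr P ws v"
  using assms
proof (induction vs arbitrary: ws thesis)
  case Nil
  then show ?case by (intro Nil.prems(1)[of 1]) simp
next
  case (Cons i vs)
  have i: "i \<le> m" and vs: "set vs \<subseteq> {..m}" using Cons.prems by auto
  have "i \<in> set ws" using Cons.prems(2) by (metis list.set_intros(1) set_mset_mset)
  then obtain as bs where ws: "ws = as @ i # bs" by (meson split_list)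
  then have "mset vs = mset (as @ bs)" using Cons.prems(2) by simp
  then obtain s :: real where s: "\<And>v. foldr P vs v = s *\<^sub>R foldr P (as @ bs) v"
    using Cons.IH vs by blast
  have "set ws \<subseteq> {..m}" using Cons.prems by (metis set_mset_mset)
  then have "set as \<subseteq> {..m}" using ws by simp
  then obtain t :: real where t: "\<And>v. P i (foldr P as v) = t *\<^sub>R foldr P as (P i v)"
    using foldr_commute i by blast
  have "foldr P (i # vs) v = (s * t) *\<^sub>R foldr P ws v" for v
    using s t ws linear_P[OF i] by (simp add: linear_scale)
  then show ?case by (rule Cons.prems(1))
qed

text \<open>A repeated letter is moved next to its twin and cancels, which shortens the word.
  Reversing k distinct letters gives the sign (-1)^(k(k-1)/2): for k = 2, 3 the word is
  skew-symmetric and its value is 0, while for k = 4, 5 it is symmetric, whence the hypothesis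
  \<open>long\<close>.\<close>

lemma inner_foldr_eq:
  assumes xy: "x \<bullet> x = y \<bullet> y" "\<And>i. i \<le> m \<Longrightarrow> P i x \<bullet> x = P i y \<bullet> y"
    and long: "\<And>ws. \<lbrakk>distinct ws; set ws \<subseteq> {..m}; length ws \<ge> 4\<rbrakk>
      \<Longrightarrow> foldr P ws x \<bullet> x = foldr P ws y \<bullet> y"
    and ws: "set ws \<subseteq> {..m}"
  shows "foldr P ws x \<bullet> x = foldr P ws y \<bullet> y"
  using ws
proof (induction ws rule: measure_induct_rule[of length])
  case (less ws)
  show ?case
  proof (cases "distinct ws")
    case False
    then obtain as bs cs i where eq: "ws = as @ [i] @ bs @ [i] @ cs"
      using not_distinct_decomp by blast
    have i: "i \<le> m" using less.prems eq by simp
    have "mset ws = mset (i # i # as @ bs @ cs)" using eq by simp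
    then obtain s :: real where "\<And>v. foldr P ws v = s *\<^sub>R foldr P (i # i # as @ bs @ cs) v"
      using foldr_mset_eq less.prems by blast
    then have s: "foldr P ws v = s *\<^sub>R foldr P (as @ bs @ cs) v" for v
      using involution[OF i] by simp
    have "foldr P (as @ bs @ cs) x \<bullet> x = foldr P (as @ bs @ cs) y \<bullet> y"
      by (rule less.IH) (use eq less.prems in auto)
    then show ?thesis using s by simp
  next
    case True
    consider "ws = []" | i where "ws = [i]" | i j where "ws = [i, j]"
      | i j k where "ws = [i, j, k]" | "length ws \<ge> 4"
      by (cases ws; cases "tl ws"; cases "tl (tl ws)"; cases "tl (tl (tl ws))") auto
    then show ?thesis
    proof cases
      case 1
      then show ?thesis using xy by simp
    next
      case 2
      then show ?thesis using xy less.prems by simp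
    next
      case (3 i j)
      then have ij: "i \<le> m" "j \<le> m" "i \<noteq> j" using less.prems True by auto
      have "P i (P j v) \<bullet> v = 0" for v
      proof -
        have "P i (P j v) \<bullet> v = v \<bullet> P j (P i v)" using ij symmetric_P by simp
        then show ?thesis using anticommute[OF ij, of v] by (simp add: inner_commute)
      qed
      then show ?thesis using 3 by simp
    next
      case (4 i j k)
      then have ijk: "i \<le> m" "j \<le> m" "k \<le> m" "i \<noteq> j" "i \<noteq> k" "j \<noteq> k"
        using less.prems True by auto
      have "P i (P j (P k v)) \<bullet> v = 0" for v
      proof -
        \<comment> \<open>Reversing three letters takes three transpositions, hence the minus
          sign.\<close>
        have "P i (P j (P k v)) = - P k (P j (P i v))"
          using ijk anticommute[of i j] anticommute[of i k] anticommute[of j k]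
            linear_neg[OF linear_P] by simp
        moreover have "P i (P j (P k v)) \<bullet> v = v \<bullet> P k (P j (P i v))"
          using ijk symmetric_P by simp
        ultimately show ?thesis by (simp add: inner_commute)
      qed
      then show ?thesis using 4 by simp
    next
      case 5
      then show ?thesis using long True less.prems by blast
    qed
  qed
qed

section \<open>Involutions from unit vectors and their action on the values\<close>

definition reflect :: "(nat \<Rightarrow> real) \<Rightarrow> real ^ 'n \<Rightarrow> real ^ 'n" where
  "reflect e v = (\<Sum>i\<le>m. e i *\<^sub>R P i v)"

lemma linear_reflect: "linear (reflect e)"
  unfolding reflect_def using linear_P
  by (intro linear_compose_sum ballI linear_compose_scale_right) auto

lemma symmetric_reflect: "reflect e v \<bullet> w = v \<bullet> reflect e w"
  unfolding reflect_def using symmetric_P by (simp add: inner_sum_left inner_sum_right)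

lemma P_reflect:
  assumes j: "j \<le> m"
  shows "P j (reflect e v) = - reflect e (P j v) + (2 * e j) *\<^sub>R v"
proof -
  have "P j (reflect e v) = (\<Sum>i\<le>m. e i *\<^sub>R P j (P i v))"
    unfolding reflect_def using linear_P[OF j] by (simp add: linear_sum linear_scale)
  \<comment> \<open>At \<open>i = j\<close> the term \<open>e j *\<^sub>R v\<close> is split as
    minus itself plus twice itself, so that the first summands run over all indices.\<close>
  also have "\<dots> = (\<Sum>i\<le>m. - (e i *\<^sub>R P i (P j v)) + (if i = j then (2 * e j) *\<^sub>R v else 0))"
  proof (intro sum.cong refl)
    fix i assume "i \<in> {..m}"
    then show "e i *\<^sub>R P j (P i v) =
        - (e i *\<^sub>R P i (P j v)) + (if i = j then (2 * e j) *\<^sub>R v else 0)"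
      using anticommute[of j i v] involution[of j v] j
      by (cases "i = j") (auto simp flip: scaleR_minus_left scaleR_add_left)
  qed
  also have "\<dots> = - reflect e (P j v) + (2 * e j) *\<^sub>R v"
    using j unfolding reflect_def sum.distrib by (simp add: sum_negf)
  finally show ?thesis .
qed

text \<open>Summing \<open>P_reflect\<close> with the weights \<open>e j\<close> shows that the
  square S of \<open>reflect e\<close> satisfies S = -S + 2 Id.\<close>

lemma reflect_involution:
  assumes e: "(\<Sum>i\<le>m. (e i)\<^sup>2) = 1"
  shows "reflect e (reflect e v) = v"
proof -
  have "reflect e (reflect e v) =
      (\<Sum>j\<le>m. - (e j *\<^sub>R reflect e (P j v)) + (2 * (e j)\<^sup>2) *\<^sub>R v)"
    unfolding reflect_def[of e "reflect e v"]
    by (intro sum.cong refl) (simp add: P_reflect algebra_simps power2_eq_square)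
  also have "\<dots> = - reflect e (reflect e v) + 2 *\<^sub>R v"
  proof -
    have "(\<Sum>j\<le>m. e j *\<^sub>R reflect e (P j v)) = reflect e (reflect e v)"
      unfolding reflect_def[of e v] using linear_reflect[of e] by (simp add: linear_sum linear_scale)
    moreover have "(\<Sum>j\<le>m. (2 * (e j)\<^sup>2) *\<^sub>R v) = 2 *\<^sub>R v"
      using e by (simp flip: scaleR_sum_left sum_distrib_left)
    ultimately show ?thesis unfolding sum.distrib by (simp add: sum_negf)
  qed
  finally have "2 *\<^sub>R reflect e (reflect e v) = 2 *\<^sub>R v"
    by (simp add: scaleR_2 eq_neg_iff_add_eq_0 algebra_simps)
  then show ?thesis by simp
qed

text \<open>The name \<open>reflect\<close> comes from here: with p the vector of the values
  \<open>P i x \<bullet> x\<close>, the new vector is 2<e,p>e - p, which keeps the component of p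
  along \<open>e\<close> and negates the part orthogonal to it.\<close>

lemma inner_P_reflect:
  assumes e: "(\<Sum>i\<le>m. (e i)\<^sup>2) = 1" and j: "j \<le> m"
  shows "P j (reflect e x) \<bullet> reflect e x = 2 * e j * (\<Sum>i\<le>m. e i * (P i x \<bullet> x)) - P j x \<bullet> x"
proof -
  have "reflect e (P j x) \<bullet> reflect e x = P j x \<bullet> x"
    by (simp add: symmetric_reflect reflect_involution[OF e])
  moreover have "x \<bullet> reflect e x = (\<Sum>i\<le>m. e i * (P i x \<bullet> x))"
    by (simp add: reflect_def inner_sum_right inner_commute)
  ultimately show ?thesis
    by (simp add: P_reflect[OF j] inner_diff_left inner_add_left)
qed

lemma orthogonal_transformation_reflect:
  assumes e: "(\<Sum>i\<le>m. (e i)\<^sup>2) = 1"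
  shows "orthogonal_transformation (reflect e)"
  unfolding orthogonal_transformation_def
  using linear_reflect by (simp add: symmetric_reflect reflect_involution[OF e])

text \<open>The map taking p to 2<e,p>e - p is an isometry: in the squared norm the terms 4<e,p>^2
  |e|^2 and -4<e,p>^2 cancel.\<close>

lemma clifford_function_reflect:
  assumes e: "(\<Sum>i\<le>m. (e i)\<^sup>2) = 1"
  shows "clifford_function m P (reflect e x) = clifford_function m P x"
proof -
  define p where "p i = P i x \<bullet> x" for i
  define t where "t = (\<Sum>i\<le>m. e i * p i)"
  have "(\<Sum>j\<le>m. (P j (reflect e x) \<bullet> reflect e x)\<^sup>2) = (\<Sum>j\<le>m. (2 * e j * t - p j)\<^sup>2)"
    using inner_P_reflect[OF e] by (intro sum.cong) (auto simp: p_def t_def)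
  also have "\<dots> = (\<Sum>j\<le>m. 4 * t\<^sup>2 * (e j)\<^sup>2 - 4 * t * (e j * p j) + (p j)\<^sup>2)"
    by (intro sum.cong) (auto simp: power2_eq_square algebra_simps)
  also have "\<dots> = 4 * t\<^sup>2 * (\<Sum>j\<le>m. (e j)\<^sup>2) - 4 * t * t + (\<Sum>j\<le>m. (p j)\<^sup>2)"
    by (simp add: sum.distrib sum_subtractf sum_distrib_left t_def)
  also have "\<dots> = (\<Sum>j\<le>m. (p j)\<^sup>2)" using e by (simp add: power2_eq_square)
  finally show ?thesis
    by (simp add: clifford_function_def atLeast0AtMost p_def)
qed

text \<open>The value vectors p of \<open>x\<close> and q of \<open>y\<close> have equal norm, so
  the direction of p + q bisects them and serves as \<open>e\<close>; if q = -p, any unit vector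
  orthogonal to p does.\<close>

lemma exists_reflect_matching:
  assumes m: "m \<ge> 1" and eq: "(\<Sum>i\<le>m. (P i x \<bullet> x)\<^sup>2) = (\<Sum>i\<le>m. (P i y \<bullet> y)\<^sup>2)"
  obtains e where "(\<Sum>i\<le>m. (e i)\<^sup>2) = 1"
    "\<And>j. j \<le> m \<Longrightarrow> P j (reflect e x) \<bullet> reflect e x = P j y \<bullet> y"
proof -
  define p q where "p i = P i x \<bullet> x" and "q i = P i y \<bullet> y" for i
  \<comment> \<open>The condition on \<open>u\<close> is homogeneous of degree 2, so it suffices to
    find a nonzero direction and normalise it.\<close>
  have unit: "\<exists>e. (\<Sum>i\<le>m. (e i)\<^sup>2) = 1 \<and> (\<forall>j\<le>m. 2 * e j * (\<Sum>i\<le>m. e i * p i) - p j = q j)"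
    if u: "i \<le> m" "u i \<noteq> 0" and pq: "\<And>j. j \<le> m \<Longrightarrow>
      2 * u j * (\<Sum>i\<le>m. u i * p i) = (p j + q j) * (\<Sum>i\<le>m. (u i)\<^sup>2)" for u i
  proof -
    define n where "n = (\<Sum>i\<le>m. (u i)\<^sup>2)"
    have n: "n > 0" unfolding n_def using u by (intro sum_pos2[of _ i]) auto
    let ?e = "\<lambda>i. u i / sqrt n"
    have "(\<Sum>i\<le>m. (?e i)\<^sup>2) = 1"
      using n by (simp add: power_divide n_def flip: sum_divide_distrib)
    moreover have "2 * ?e j * (\<Sum>i\<le>m. ?e i * p i) - p j = q j" if "j \<le> m" for j
    proof -
      have "2 * ?e j * (\<Sum>i\<le>m. ?e i * p i) = 2 * u j * (\<Sum>i\<le>m. u i * p i) / n"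
        using n by (simp add: divide_simps flip: sum_divide_distrib)
      also have "\<dots> = p j + q j" using pq[OF that] n by (simp add: n_def)
      finally show ?thesis by simp
    qed
    ultimately show ?thesis by (intro exI[of _ ?e]) blast
  qed
  have "\<exists>e. (\<Sum>i\<le>m. (e i)\<^sup>2) = 1 \<and> (\<forall>j\<le>m. 2 * e j * (\<Sum>i\<le>m. e i * p i) - p j = q j)"
  proof (cases "\<exists>i\<le>m. p i + q i \<noteq> 0")
    case True
    then obtain i where i: "i \<le> m" "p i + q i \<noteq> 0" by blast
    \<comment> \<open>Since |p| = |q|, this gives |p + q|^2 = 2<p + q, p>, which is what
      \<open>unit\<close> asks for the direction p + q.\<close>
    have "(\<Sum>i\<le>m. (p i + q i)\<^sup>2) = (\<Sum>i\<le>m. 2 * ((p i + q i) * p i) + ((q i)\<^sup>2 - (p i)\<^sup>2))"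
      by (intro sum.cong) (auto simp: power2_eq_square algebra_simps)
    also have "\<dots> = 2 * (\<Sum>i\<le>m. (p i + q i) * p i)"
      using eq by (simp add: sum.distrib sum_subtractf p_def q_def flip: sum_distrib_left)
    finally show ?thesis by (intro unit[of i "\<lambda>i. p i + q i"] i) simp
  next
    case False
    then have q: "q i = - p i" if "i \<le> m" for i using that by (simp add: eq_neg_iff_add_eq_0 add.commute)
    \<comment> \<open>any nonzero vector orthogonal to \<open>p\<close>; it exists since \<open>m \<ge> 1\<close>\<close>
    define u :: "nat \<Rightarrow> real" where
      "u i = (if p 0 = 0 then of_bool (i = 0) else if i = 0 then - p 1 else of_bool (i = 1) * p 0)" for i
    have "(\<Sum>i\<le>m. u i * p i) = (\<Sum>i\<in>{0, 1}. u i * p i)"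
      using m by (intro sum.mono_neutral_right) (auto simp: u_def)
    also have "\<dots> = 0" by (simp add: u_def)
    finally have orth: "(\<Sum>i\<le>m. u i * p i) = 0" .
    \<comment> \<open>Both sides of the condition in \<open>unit\<close> vanish, as \<open>u\<close>
      is orthogonal to \<open>p\<close> and p + q = 0. The index is a place where \<open>u\<close>
      is nonzero: \<open>u 0\<close> is 1 in the first case and \<open>u 1\<close> is
      \<open>p 0\<close> in the second.\<close>
    show ?thesis
      by (rule unit[of "if p 0 = 0 then 0 else 1" u])
        (use m q orth in \<open>auto simp: u_def\<close>)
  qed
  then obtain e where "(\<Sum>i\<le>m. (e i)\<^sup>2) = 1"
    "\<And>j. j \<le> m \<Longrightarrow> 2 * e j * (\<Sum>i\<le>m. e i * p i) - p j = q j" by blast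
  then show thesis using that[of e] inner_P_reflect[of e] by (simp add: p_def q_def)
qed

section \<open>Transitivity on the level sets and the three cases\<close>

lemma homogeneous_family_if_long_words:
  assumes m: "m \<ge> 1"
    and long: "\<And>ws x y. \<lbrakk>distinct ws; set ws \<subseteq> {..m}; length ws \<ge> 4; x \<bullet> x = y \<bullet> y;
      \<And>i. i \<le> m \<Longrightarrow> P i x \<bullet> x = P i y \<bullet> y\<rbrakk> \<Longrightarrow> foldr P ws x \<bullet> x = foldr P ws y \<bullet> y"
  shows "homogeneous_family (clifford_family m P)"
  unfolding homogeneous_family_def homogeneously_embedded_def
proof (intro ballI)
  fix M x y assume "M \<in> clifford_family m P" and x: "x \<in> M" and y: "y \<in> M"
  then obtain c where M: "M = {x \<in> sphere 0 1. clifford_function m P x = c}"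
    unfolding clifford_family_def by blast
  have "clifford_function m P x = clifford_function m P y" using x y M by simp
  then have "(\<Sum>i\<le>m. (P i x \<bullet> x)\<^sup>2) = (\<Sum>i\<le>m. (P i y \<bullet> y)\<^sup>2)"
    by (simp add: clifford_function_def atLeast0AtMost)
  then obtain e where e: "(\<Sum>i\<le>m. (e i)\<^sup>2) = 1"
    and match: "\<And>j. j \<le> m \<Longrightarrow> P j (reflect e x) \<bullet> reflect e x = P j y \<bullet> y"
    using exists_reflect_matching[OF m] by metis
  \<comment> \<open>Now \<open>z\<close> has the same values as \<open>y\<close>, and it remains to
    move \<open>z\<close> to \<open>y\<close> by a map that preserves each value.\<close>
  define z where "z = reflect e x"
  have re: "orthogonal_transformation (reflect e)"
    using orthogonal_transformation_reflect[OF e] .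
  have "norm z = norm y" unfolding z_def
    using x y M orthogonal_transformation_norm[OF re] by simp
  then have zy: "z \<bullet> z = y \<bullet> y" by (simp add: dot_square_norm)
  have "foldr P ws z \<bullet> z = foldr P ws y \<bullet> y" if "set ws \<subseteq> {..m}" for ws
    using inner_foldr_eq[OF zy] match long zy that unfolding z_def by blast
  then obtain A where A: "orthogonal_transformation A" "A z = y"
    and comm: "\<And>i v. i \<le> m \<Longrightarrow> A (P i v) = P i (A v)"
    using commuting_orthogonal_transformation_exists[of "{..m}" P z y] linear_P symmetric_P
    by (metis atMost_iff)
  let ?B = "A \<circ> reflect e"
  have B: "orthogonal_transformation ?B" using A(1) re by (rule orthogonal_transformation_compose)
  \<comment> \<open>An isometry that commutes with \<open>P i\<close> preserves its quadratic
    form.\<close>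
  have "P i (A v) \<bullet> A v = P i v \<bullet> v" if "i \<le> m" for i v
    using comm[OF that, symmetric] A(1) by (simp add: orthogonal_transformation_def)
  then have "clifford_function m P (A v) = clifford_function m P v" for v
    by (simp add: clifford_function_def)
  then have f: "clifford_function m P (?B v) = clifford_function m P v" for v
    by (simp add: clifford_function_reflect[OF e])
  have iff: "?B v \<in> M \<longleftrightarrow> v \<in> M" for v
    using f orthogonal_transformation_norm[OF B] by (simp add: M)
  have "?B ` M = M"
  proof
    show "?B ` M \<subseteq> M" using iff by blast
    show "M \<subseteq> ?B ` M"
      using iff orthogonal_transformation_surj[OF B] by (metis (no_types, lifting) image_iff subsetI surjD)
  qed
  then have "?B \<in> symmetry_group M" using B by (simp add: symmetry_group_def)
  moreover have "?B x = y" using A(2) z_def by simp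
  ultimately show "\<exists>A\<in>symmetry_group M. A x = y" by blast
qed

text \<open>At most three letters are available, so there is no word with four distinct
  letters.\<close>

lemma homogeneous_family_le_2:
  assumes "1 \<le> m" "m \<le> 2"
  shows "homogeneous_family (clifford_family m P)"
proof (rule homogeneous_family_if_long_words[OF assms(1)])
  fix ws x y assume "distinct ws" "set ws \<subseteq> {..m}" "length ws \<ge> 4"
  then have "4 \<le> card {..m}" by (metis card_mono distinct_card finite_atMost le_trans)
  then show "foldr P ws x \<bullet> x = foldr P ws y \<bullet> y" using assms(2) by simp
qed

text \<open>A word in all five letters is a scalar by \<open>prod\<close>; a word in four distinct
  letters is then a multiple of the missing letter.\<close>

lemma homogeneous_family_4:
  assumes m: "m = 4"
    and prod: "P 0 \<circ> P 1 \<circ> P 2 \<circ> P 3 \<circ> P 4 = id \<or> P 0 \<circ> P 1 \<circ> P 2 \<circ> P 3 \<circ> P 4 = (\<lambda>x. - x)"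
  shows "homogeneous_family (clifford_family m P)"
proof (rule homogeneous_family_if_long_words)
  show "1 \<le> m" using m by simp
  fix ws x y
  assume ws: "distinct ws" "set ws \<subseteq> {..m}" "length ws \<ge> 4"
    and xy: "x \<bullet> x = y \<bullet> y" "\<And>i. i \<le> m \<Longrightarrow> P i x \<bullet> x = P i y \<bullet> y"
  have full: "\<exists>s::real. \<forall>v. foldr P vs v = s *\<^sub>R v" if vs: "distinct vs" "set vs = {..m}" for vs
  proof -
    have "{..4::nat} = set [0, 1, 2, 3, 4]" by (intro set_eqI) (simp, presburger)
    then have "set vs = set [0, 1, 2, 3, 4]" using vs(2) m by simp
    then have "mset vs = mset [0, 1, 2, 3, 4]"
      using vs(1) by (subst set_eq_iff_mset_eq_distinct[symmetric]) auto
    then obtain s :: real where s: "\<And>v. foldr P vs v = s *\<^sub>R foldr P [0, 1, 2, 3, 4] v"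
      using foldr_mset_eq vs(2) by blast
    from prod obtain t :: real where "\<And>v. foldr P [0, 1, 2, 3, 4] v = t *\<^sub>R v"
    proof
      assume "P 0 \<circ> P 1 \<circ> P 2 \<circ> P 3 \<circ> P 4 = id"
      then show thesis using that[of 1] by (simp add: fun_eq_iff)
    next
      assume "P 0 \<circ> P 1 \<circ> P 2 \<circ> P 3 \<circ> P 4 = (\<lambda>x. - x)"
      then show thesis using that[of "-1"] by (simp add: fun_eq_iff)
    qed
    then have "foldr P vs v = (s * t) *\<^sub>R v" for v using s by simp
    then show ?thesis by blast
  qed
  show "foldr P ws x \<bullet> x = foldr P ws y \<bullet> y"
  proof (cases "set ws = {..m}")
    case True
    then obtain s :: real where "\<And>v. foldr P ws v = s *\<^sub>R v" using full ws(1) by blast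
    then show ?thesis using xy(1) by simp
  next
    case False
    \<comment> \<open>Prefixing the missing letter \<open>j\<close> gives a word in all five
      letters, and applying the involution \<open>P j\<close> recovers \<open>ws\<close>.\<close>
    then obtain j where j: "j \<le> m" "j \<notin> set ws" using ws(2) by auto
    have "card (set (j # ws)) = length (j # ws)" using ws(1) j(2) by (intro distinct_card) simp
    then have "card {..m} \<le> card (set (j # ws))" using ws(3) m by simp
    then have "set (j # ws) = {..m}" using j(1) ws(2) by (intro card_seteq) auto
    then obtain s :: real where s: "\<And>v. foldr P (j # ws) v = s *\<^sub>R v"
      using full[of "j # ws"] ws(1) j(2) by auto
    have "foldr P ws v = s *\<^sub>R P j v" for v
    proof -
      have "foldr P ws v = P j (foldr P (j # ws) v)" using involution[OF j(1)] by simp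
      then show ?thesis using s linear_P[OF j(1)] by (simp add: linear_scale)
    qed
    then show ?thesis using xy(2)[OF j(1)] by simp
  qed
qed

end

theorem theorem6p1:
  fixes P :: "nat \<Rightarrow> real ^ 'n \<Rightarrow> real ^ 'n" and k :: nat
  assumes "k \<ge> 1"
  shows "(clifford_family_multiplicities P 1 k
            \<longrightarrow> homogeneous_family (clifford_family 1 P)) \<and>
         (clifford_family_multiplicities P 2 (2 * k - 1)
            \<longrightarrow> homogeneous_family (clifford_family 2 P)) \<and>
         (clifford_family_multiplicities P 4 (4 * k - 1) \<and>
          (P 0 \<circ> P 1 \<circ> P 2 \<circ> P 3 \<circ> P 4 = id \<or> P 0 \<circ> P 1 \<circ> P 2 \<circ> P 3 \<circ> P 4 = (\<lambda>x. - x))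
            \<longrightarrow> homogeneous_family (clifford_family 4 P))"
  using clifford.homogeneous_family_le_2[of 1 P] clifford.homogeneous_family_le_2[of 2 P]
    clifford.homogeneous_family_4[of 4 P]
  by (auto simp: clifford_def clifford_family_multiplicities_def)

end
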